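(* Let $B$ be a non-trivial Boolean algebra, let $\mathscr K$ be an ultracontact on $B$ and let $\{\mathscr K_i : i\in I\}$ be a family of ultracontacts on $B$. Then, with meets $\bigwedge$ taken in the lattice $\mathrm{UC}(B)$, \[\mathscr K\cup\bigwedge_{i\in I}\mathscr K_i=\bigwedge_{i\in I}(\mathscr K\cup\mathscr K_i).\]
   Context: Let $B$ be a non-trivial Boolean algebra with operations $+,\cdot,-$, constants $0,1$ and order $\le$. For $F,G\subseteq B$ put $F+G=\{f+g: f\in F,\ g\in G\}$, and write $F\preceq G$ iff for every $g\in G$ there is $f\in F$ with $f\le g$. An ultracontact on $B$ is a family $\mathscr K\subseteq 2^B$ such that for all $F,G\subseteq B$: (K0) $\emptyset\notin\mathscr K$; (K1) if $0\in F$ then $F\notin\mathscr K$; (K2) if $x\neq 0$ then $\{x\}\in\mathscr K$; (K3) if $F\preceq G$, $G\neq\emptyset$ and $F\in\mathscr K$, then $G\in\mathscr K$; (K4) if $F+G\in\mathscr K$ then $F\in\mathscr K$ or $G\in\mathscr K$. $\mathrm{UC}(B)$ is the set of ultracontacts on $B$ ordered by inclusion; it is a complete lattice in which unions of ultracontacts are ultracontacts (so each $\mathscr K\cup\mathscr K_i$ is an ultracontact), and $\bigwedge$ denotes the meet in this lattice. *)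

theory Defs
  imports "HOL-Algebra.Complete_Lattice"
begin

text \<open>
  HOL-Algebra reuses the names \<open>sup\<close>, \<open>inf\<close>, \<open>top\<close> for structures with a carrier; the
  qualified names below are the operations of the type class of Boolean algebras.
\<close>

definition set_join :: "'a::boolean_algebra set \<Rightarrow> 'a set \<Rightarrow> 'a set" (infixl "+\<^sub>B" 65)
  where "F +\<^sub>B G = {sup_class.sup f g | f g. f \<in> F \<and> g \<in> G}"

definition coarser :: "'a::boolean_algebra set \<Rightarrow> 'a set \<Rightarrow> bool" (infix "\<preceq>" 50)
  where "F \<preceq> G \<longleftrightarrow> (\<forall>g\<in>G. \<exists>f\<in>F. f \<le> g)"

definition ultracontact :: "'a::boolean_algebra set set \<Rightarrow> bool"
  where "ultracontact K \<longleftrightarrow>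
    {} \<notin> K \<and>
    (\<forall>F. bot_class.bot \<in> F \<longrightarrow> F \<notin> K) \<and>
    (\<forall>x. x \<noteq> bot_class.bot \<longrightarrow> {x} \<in> K) \<and>
    (\<forall>F G. F \<preceq> G \<and> G \<noteq> {} \<and> F \<in> K \<longrightarrow> G \<in> K) \<and>
    (\<forall>F G. F +\<^sub>B G \<in> K \<longrightarrow> F \<in> K \<or> G \<in> K)"

definition UC :: "'a::boolean_algebra set set gorder"
  where "UC = \<lparr>carrier = {K. ultracontact K}, eq = (=), le = (\<subseteq>)\<rparr>"

lemma carrier_UC [simp]: "carrier UC = {K. ultracontact K}"
  and eq_UC [simp]: "(.=\<^bsub>UC\<^esub>) = (=)"
  and le_UC [simp]: "(\<sqsubseteq>\<^bsub>UC\<^esub>) = (\<subseteq>)"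
  by (simp_all add: UC_def)

lemma ultracontact_Union:
  assumes "A \<noteq> {}" "\<And>K. K \<in> A \<Longrightarrow> ultracontact K"
  shows "ultracontact (\<Union>A)"
proof -
  have "\<exists>K\<in>A. {x} \<in> K" if "x \<noteq> bot_class.bot" for x
    using assms that by (metis ex_in_conv ultracontact_def)
  moreover have "\<exists>K\<in>A. G \<in> K" if "F \<preceq> G" "G \<noteq> {}" "K \<in> A" "F \<in> K" for F G K
    using assms(2)[OF that(3)] that unfolding ultracontact_def by blast
  moreover have "(\<exists>K\<in>A. F \<in> K) \<or> (\<exists>K\<in>A. G \<in> K)" if "K \<in> A" "F +\<^sub>B G \<in> K" for F G K
    using assms(2)[OF that(1)] that unfolding ultracontact_def by blast
  moreover have "{} \<notin> K" "bot_class.bot \<in> F \<Longrightarrow> F \<notin> K" if "K \<in> A" for K F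
    using assms(2)[OF that] unfolding ultracontact_def by blast+
  ultimately show ?thesis
    unfolding ultracontact_def Union_iff by blast
qed

definition least_ultracontact :: "'a::boolean_algebra set set"
  where "least_ultracontact = {F. F \<noteq> {} \<and> (\<exists>x. x \<noteq> bot_class.bot \<and> (\<forall>f\<in>F. x \<le> f))}"

lemma ultracontact_least: "ultracontact least_ultracontact"
proof -
  have "F \<in> least_ultracontact \<or> G \<in> least_ultracontact"
    if FG: "F +\<^sub>B G \<in> least_ultracontact" for F G :: "'a set"
  proof -
    from FG obtain x where x: "x \<noteq> bot_class.bot"
      and le: "\<And>f g. f \<in> F \<Longrightarrow> g \<in> G \<Longrightarrow> x \<le> sup_class.sup f g"
      and ne: "F \<noteq> {}" "G \<noteq> {}"
      unfolding least_ultracontact_def set_join_def by blast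
    show ?thesis
    proof (cases "\<forall>f\<in>F. x \<le> f")
      case True
      then show ?thesis using x ne by (auto simp: least_ultracontact_def)
    next
      case False
      then obtain f where f: "f \<in> F" "\<not> x \<le> f" by blast
      have "inf_class.inf x (- f) \<noteq> bot_class.bot"
        using f(2) by (metis inf_shunt double_compl)
      moreover have "inf_class.inf x (- f) \<le> g" if "g \<in> G" for g
        using le[OF f(1) that] by (simp add: shunt1)
      ultimately show ?thesis using ne by (auto simp: least_ultracontact_def)
    qed
  qed
  moreover have "G \<in> least_ultracontact"
    if "F \<preceq> G" "G \<noteq> {}" "F \<in> least_ultracontact" for F G :: "'a set"
    using that unfolding least_ultracontact_def coarser_def by (blast intro: order_trans)
  moreover have "{} \<notin> least_ultracontact"
    by (simp add: least_ultracontact_def)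
  moreover have "F \<notin> least_ultracontact" if "bot_class.bot \<in> F" for F :: "'a set"
    using that bot.extremum_uniqueI by (auto simp: least_ultracontact_def)
  moreover have "{x} \<in> least_ultracontact" if "x \<noteq> bot_class.bot" for x :: 'a
    using that by (auto simp: least_ultracontact_def)
  ultimately show ?thesis unfolding ultracontact_def by blast
qed

lemma least_ultracontact_le:
  assumes "ultracontact K" shows "least_ultracontact \<subseteq> K"
proof
  fix F :: "'a set"
  assume "F \<in> least_ultracontact"
  then obtain x where "x \<noteq> bot_class.bot" "{x} \<preceq> F" "F \<noteq> {}"
    by (auto simp: least_ultracontact_def coarser_def)
  with assms show "F \<in> K" unfolding ultracontact_def by blast
qed

text \<open>Hence the meets \<open>\<Sqinter>\<^bsub>UC\<^esub>A\<close> of the library, defined by choice, exist.\<close>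

lemma complete_lattice_UC: "complete_lattice (UC :: 'a::boolean_algebra set set gorder)"
proof -
  interpret partial_order "UC :: 'a set set gorder"
    by unfold_locales auto
  show ?thesis
  proof (rule complete_latticeI)
    fix A :: "'a set set set"
    assume A: "A \<subseteq> carrier UC"
    have "ultracontact (least_ultracontact \<union> \<Union>A)"
      using ultracontact_Union[of "insert least_ultracontact A"] A ultracontact_least by auto
    then show "\<exists>s. least UC s (Upper UC A)"
      using A least_ultracontact_le
      by (intro exI[of _ "least_ultracontact \<union> \<Union>A"] least_UpperI) (auto simp: Upper_def)
    have "least_ultracontact \<in> Lower UC A"
      using A ultracontact_least least_ultracontact_le by (auto simp: Lower_def)
    then have "ultracontact (\<Union>(Lower UC A))"
      by (intro ultracontact_Union) (auto simp: Lower_def)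
    then show "\<exists>i. greatest UC i (Lower UC A)"
      using A by (intro exI[of _ "\<Union>(Lower UC A)"] greatest_LowerI) (auto simp: Lower_def)
  qed
qed

end

theory Submission
  imports Defs
begin

text \<open>
  An ultracontact is determined by the non-empty up-sets whose generating families it leaves out.
  Such up-sets form a filter, and under this correspondence \<open>F +\<^sub>B G\<close> becomes intersection,
  \<open>F \<union> G\<close> becomes union and inclusion of ultracontacts is reversed. So the equation is the frame
  law in the lattice of filters of a distributive lattice, and it follows from the existence of
  relative pseudocomplements there: for ultracontacts \<open>K\<close> and \<open>L\<close> there is a least ultracontact
  \<open>M\<close> with \<open>L \<subseteq> K \<union> M\<close>, and \<open>M\<close> lies below every \<open>K\<^sub>i\<close> with \<open>L \<subseteq> K \<union> K\<^sub>i\<close>.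
\<close>

lemma ultracontactI:
  assumes "{} \<notin> K"
    and "\<And>F. bot_class.bot \<in> F \<Longrightarrow> F \<notin> K"
    and "\<And>x. x \<noteq> bot_class.bot \<Longrightarrow> {x} \<in> K"
    and "\<And>F G. F \<in> K \<Longrightarrow> F \<preceq> G \<Longrightarrow> G \<noteq> {} \<Longrightarrow> G \<in> K"
    and "\<And>F G. F +\<^sub>B G \<in> K \<Longrightarrow> F \<in> K \<or> G \<in> K"
  shows "ultracontact K"
  using assms unfolding ultracontact_def by blast

lemma ultracontactD:
  assumes "ultracontact K"
  shows "{} \<notin> K"
    and "bot_class.bot \<in> F \<Longrightarrow> F \<notin> K"
    and "x \<noteq> bot_class.bot \<Longrightarrow> {x} \<in> K"
    and "F \<in> K \<Longrightarrow> F \<preceq> G \<Longrightarrow> G \<noteq> {} \<Longrightarrow> G \<in> K"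
    and "F +\<^sub>B G \<in> K \<Longrightarrow> F \<in> K \<or> G \<in> K"
  using assms unfolding ultracontact_def by blast+

lemma coarser_subset: "G \<subseteq> F \<Longrightarrow> F \<preceq> G"
  unfolding coarser_def by blast

lemma coarser_Un_mono: "G \<preceq> G' \<Longrightarrow> F \<union> G \<preceq> F \<union> G'"
  unfolding coarser_def by blast

text \<open>Half of a distributive law for up-sets: a sum with a summand in \<open>F\<close> lies
  above that summand, and any other sum is in \<open>G +\<^sub>B H\<close>.\<close>

lemma coarser_Un_set_join: "F \<union> (G +\<^sub>B H) \<preceq> (F \<union> G) +\<^sub>B (F \<union> H)"
  unfolding coarser_def set_join_def by (blast intro: sup.cobounded1 sup.cobounded2)

text \<open>The second set negates the formula for implication between filters: all \<open>F\<close>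
  in the first filter have \<open>F \<union> G\<close> in the second. It is empty if, say,
  \<open>K\<close> is an ultracontact with \<open>L \<subseteq> K\<close>;
  \<open>least_ultracontact\<close> then provides the singletons for K2.\<close>

definition contact_diff :: "'a::boolean_algebra set set \<Rightarrow> 'a set set \<Rightarrow> 'a set set"
  where "contact_diff L K =
    least_ultracontact \<union> {G. G \<noteq> {} \<and> (\<exists>F. F \<noteq> {} \<and> F \<notin> K \<and> F \<union> G \<in> L)}"

text \<open>Adjoining a fixed witness \<open>F\<close> reduces K1, K3 and K4 for the second set to
  those of \<open>L\<close>; distributivity enters in K4.\<close>

lemma ultracontact_contact_diff:
  assumes L: "ultracontact L"
  shows "ultracontact (contact_diff L K)"
proof -
  let ?M = "{G. G \<noteq> {} \<and> (\<exists>F. F \<noteq> {} \<and> F \<notin> K \<and> F \<union> G \<in> L)}"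
  note least = ultracontactD[OF ultracontact_least]
  have K4: "G \<in> ?M \<or> H \<in> ?M" if GH: "G +\<^sub>B H \<in> ?M" for G H
  proof -
    from GH obtain F where F: "F \<noteq> {}" "F \<notin> K" "F \<union> (G +\<^sub>B H) \<in> L" and "G +\<^sub>B H \<noteq> {}"
      by blast
    then have ne: "G \<noteq> {}" "H \<noteq> {}"
      by (auto simp: set_join_def)
    \<comment> \<open>Any \<open>f\<close> in \<open>F\<close> gives the sum of \<open>f\<close>
      with itself.\<close>
    have "(F \<union> G) +\<^sub>B (F \<union> H) \<noteq> {}"
      using F(1) by (auto simp: set_join_def)
    then have "(F \<union> G) +\<^sub>B (F \<union> H) \<in> L"
      by (rule ultracontactD(4)[OF L F(3) coarser_Un_set_join])
    then have "F \<union> G \<in> L \<or> F \<union> H \<in> L"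
      by (rule ultracontactD(5)[OF L])
    with F ne show ?thesis by blast
  qed
  have K3: "H \<in> ?M" if "G \<in> ?M" "G \<preceq> H" "H \<noteq> {}" for G H
  proof -
    from that(1) obtain F where F: "F \<noteq> {}" "F \<notin> K" "F \<union> G \<in> L"
      by blast
    have "F \<union> H \<in> L"
      by (rule ultracontactD(4)[OF L F(3) coarser_Un_mono[OF that(2)]]) (simp add: F(1))
    with F that(3) show ?thesis by blast
  qed
  have K1: "F \<notin> ?M" if "bot_class.bot \<in> F" for F
    using that ultracontactD(2)[OF L] by blast
  define M where "M = ?M"
  have M: "contact_diff L K = least_ultracontact \<union> M"
    by (simp add: contact_diff_def M_def)
  show ?thesis
    unfolding M
  proof (rule ultracontactI)
    show "{} \<notin> least_ultracontact \<union> M"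
      using least(1) by (simp add: M_def)
    show "F \<notin> least_ultracontact \<union> M" if "bot_class.bot \<in> F" for F
      using least(2)[OF that] K1[OF that] by (simp add: M_def)
    show "{x} \<in> least_ultracontact \<union> M" if "x \<noteq> bot_class.bot" for x
      using least(3)[OF that] by simp
    show "H \<in> least_ultracontact \<union> M"
      if "G \<in> least_ultracontact \<union> M" "G \<preceq> H" "H \<noteq> {}" for G H
      using that(1) least(4)[OF _ that(2,3)] K3[OF _ that(2,3), folded M_def] by blast
    show "G \<in> least_ultracontact \<union> M \<or> H \<in> least_ultracontact \<union> M"
      if "G +\<^sub>B H \<in> least_ultracontact \<union> M" for G H
      using that least(5)[of G H] K4[of G H, folded M_def] by blast
  qed
qed

text \<open>K3 passes membership down to non-empty subfamilies. So \<open>F \<union> G\<close> is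
  outside \<open>K\<close> because \<open>F\<close> is, hence it is in \<open>J\<close>, and then so
  is \<open>G\<close>.\<close>

lemma contact_diff_subset:
  assumes K: "ultracontact K" and J: "ultracontact J" and sub: "L \<subseteq> K \<union> J"
  shows "contact_diff L K \<subseteq> J"
proof
  fix G assume "G \<in> contact_diff L K"
  then consider "G \<in> least_ultracontact"
    | F where "G \<noteq> {}" "F \<noteq> {}" "F \<notin> K" "F \<union> G \<in> L"
    unfolding contact_diff_def by blast
  then show "G \<in> J"
  proof cases
    case 1
    then show ?thesis using least_ultracontact_le[OF J] by blast
  next
    case 2
    have "F \<union> G \<notin> K"
      using ultracontactD(4)[OF K _ coarser_subset[of F "F \<union> G"]] 2 by auto
    then have "F \<union> G \<in> J"
      using sub 2 by blast
    then show ?thesis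
      using ultracontactD(4)[OF J _ coarser_subset[of G "F \<union> G"]] 2 by auto
  qed
qed

lemma subset_Un_contact_diff:
  assumes "ultracontact L"
  shows "L \<subseteq> K \<union> contact_diff L K"
proof
  fix F assume "F \<in> L"
  \<comment> \<open>If \<open>F\<close> is not in \<open>K\<close>, it is its own witness for
    membership in \<open>contact_diff L K\<close>.\<close>
  then have "F \<noteq> {}" "F \<union> F \<in> L"
    using ultracontactD(1)[OF assms] by auto
  then show "F \<in> K \<union> contact_diff L K"
    unfolding contact_diff_def by blast
qed

theorem theorem4p11:
  fixes K :: "'a::boolean_algebra set set"
    and KK :: "'i \<Rightarrow> 'a set set"
    and I :: "'i set"
  assumes nontrivial: "(bot_class.bot :: 'a) \<noteq> top_class.top"
    and "ultracontact K"
    and "\<And>i. i \<in> I \<Longrightarrow> ultracontact (KK i)"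
  shows "K \<union> (IINF\<^bsub>UC\<^esub> i:I. KK i) = (IINF\<^bsub>UC\<^esub> i:I. K \<union> KK i)"
proof -
  interpret complete_lattice "UC :: 'a set set gorder"
    by (rule complete_lattice_UC)
  have un: "ultracontact (K \<union> J)" if "ultracontact J" for J
    using ultracontact_Union[of "{K, J}"] assms(2) that by auto
  define N where "N = (IINF\<^bsub>UC\<^esub> i:I. KK i)"
  define L where "L = (IINF\<^bsub>UC\<^esub> i:I. K \<union> KK i)"
  have sub: "KK ` I \<subseteq> carrier UC" "(\<lambda>i. K \<union> KK i) ` I \<subseteq> carrier UC"
    using assms(3) un by auto
  have N: "ultracontact N" and L: "ultracontact L"
    using inf_closed[OF sub(1)] inf_closed[OF sub(2)] by (simp_all add: N_def L_def infi_def)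
  have N_le: "N \<subseteq> KK i" if "i \<in> I" for i
    using inf_lower[OF sub(1), of "KK i"] that by (simp add: N_def infi_def)
  have L_le: "L \<subseteq> K \<union> KK i" if "i \<in> I" for i
    using inf_lower[OF sub(2), of "K \<union> KK i"] that by (simp add: L_def infi_def)
  have N_greatest: "M \<subseteq> N" if "ultracontact M" "\<And>i. i \<in> I \<Longrightarrow> M \<subseteq> KK i" for M
    using inf_greatest[OF sub(1), of M] that by (auto simp: N_def infi_def)
  have L_greatest: "M \<subseteq> L" if "ultracontact M" "\<And>i. i \<in> I \<Longrightarrow> M \<subseteq> K \<union> KK i" for M
    using inf_greatest[OF sub(2), of M] that by (auto simp: L_def infi_def)
  \<comment> \<open>The easy inclusion: \<open>K \<union> N\<close> is an ultracontact below every
    \<open>K \<union> KK i\<close>.\<close>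
  have "K \<union> N \<subseteq> L"
    using L_greatest[OF un[OF N]] N_le by blast
  \<comment> \<open>\<open>contact_diff L K\<close> does not depend on \<open>i\<close>, so it is
    one lower bound for all \<open>KK i\<close> at once, however large \<open>I\<close> is.\<close>
  moreover have "contact_diff L K \<subseteq> N"
    using N_greatest[OF ultracontact_contact_diff[OF L]]
      contact_diff_subset[OF assms(2) assms(3) L_le] by blast
  then have "L \<subseteq> K \<union> N"
    using subset_Un_contact_diff[OF L, of K] by blast
  ultimately show ?thesis
    unfolding N_def L_def by blast
qed

end
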